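(* Fix a slot $t_k$ in frame $k$, the scheduling indicators $a_{m,n}[k]\in\{0,1\}$ (hence the scheduled sets $\mathcal N_m^{\mathrm{ACT}}[k]$), the channels, harvested energies and backlogs, as described in the context. For $\phi\in[0,1]$ let $f_{m,n}(\phi)=\sqrt{\exp(q^A_{m,n}(t_k)\phi)-1}$, and consider the convex problem of minimizing, over the beamforming vectors $\boldsymbol w_{m,n}$ and the exchanged energies $\delta_m^l$, $$\sum_{m=1}^M\Big[V(\alpha_b-\alpha_s)X_m^+ + V\alpha_s X_m+\sum_{n\in\mathcal N_m^{\mathrm{ACT}}[k]}(q^U_{m,n}[k]-q^A_{m,n}[k])\,q^A_{m,n}(t_k)\,\phi\Big]$$ subject to (a) $\delta_m^l+\delta_l^m=0$ for $l\in\mathcal N_m$ and all $m$; (b) $\dfrac{\boldsymbol h_{m,n}^H\boldsymbol w_{m,n}}{f_{m,n}(\phi)}\ge\sqrt{I^{\mathrm{INTRA}}_{m,n}+I^{\mathrm{INTER}}_{m,n}+\sigma_{m,n}^2}$ for $n\in\mathcal N_m^{\mathrm{ACT}}[k]$ and all $m$; (c) $\Im(\boldsymbol h_{m,n}^H\boldsymbol w_{m,n})=0$ for $n\in\mathcal N_m^{\mathrm{ACT}}[k]$ and all $m$; (d) $\sum_{n\in\mathcal N_m^{\mathrm{ACT}}[k]}\|\boldsymbol w_{m,n}\|^2\le P_m^{\max}$ for all $m$. Then, for given $\phi$, at an optimal solution all the constraints (b) are active, i.e. hold with equality. Consequently the relaxation is tight: with $\phi$ chosen optimally in $[0,1]$,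 the optimal value $\overline{\mathcal{OPT}}(t_k)$ of this problem equals the optimal value $\mathcal{OPT}(t_k)$ of the per-slot problem $$\min_{\{\boldsymbol w_{m,n},\,\delta_m^l\}}\ \sum_{m=1}^M\sum_{n=1}^{N_m}(q^U_{m,n}[k]-q^A_{m,n}[k])\,r_{m,n}+V\sum_{m=1}^M G_m^{\mathrm{SG}}$$ subject to: $\delta_m^l+\delta_l^m=0$ for all $m,l$; $r_{m,n}\le q^A_{m,n}(t_k)$ for all $m,n$; $r_{m,n}/r_{j,i}=q^A_{m,n}(t_k)/q^A_{j,i}(t_k)$ for all $m,j$, $n\in\mathcal N_m^{\mathrm{ACT}}[k]$, $i\in\mathcal N_j^{\mathrm{ACT}}[k]$; and (d).
   Context: There are $M$ base stations (BSTs) with $L$ antennas each; BST $m$ serves $N_m$ single-antenna users $(m,n)$, $n=1,\dots,N_m$. A frame $k$ consists of $T$ slots $t_k$, and all slot-$t_k$ quantities below are written without the argument $t_k$. $a_{m,n}[k]\in\{0,1\}$ indicates whether user $(m,n)$ is scheduled in frame $k$, and $\mathcal N_m^{\mathrm{ACT}}[k]=\{n:a_{m,n}[k]=1\}$. $\boldsymbol h_{j,(m,n)}\in\mathbb C^L$ is the channel from BST $j$ to user $(m,n)$, with $\boldsymbol h_{m,n}=\boldsymbol h_{m,(m,n)}$; $\boldsymbol w_{m,n}\in\mathbb C^L$ is the beamforming vector for user $(m,n)$; $\sigma_{m,n}^2>0$ is the noise power. Interference: $$I_{m,n}^{\mathrm{INTRA}}=\sum_{i\ne n}a_{m,i}[k]|\boldsymbol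 h_{m,n}^H\boldsymbol w_{m,i}|^2,\qquad I_{m,n}^{\mathrm{INTER}}=\sum_{j\ne m}\sum_{i=1}^{N_j}a_{j,i}[k]|\boldsymbol h_{j,(m,n)}^H\boldsymbol w_{j,i}|^2.$$ Data rate (natural logarithm): $$r_{m,n}=\log\Big(1+\frac{a_{m,n}[k]|\boldsymbol h_{m,n}^H\boldsymbol w_{m,n}|^2}{I_{m,n}^{\mathrm{INTRA}}+I_{m,n}^{\mathrm{INTER}}+\sigma_{m,n}^2}\Big).$$ $\delta_m^l\in\mathbb R$ is the energy delivered from BST $m$ to BST $l$ ($\delta_m^m=0$), and $\mathcal N_m$ is the set of BSTs joined to BST $m$ by a one-hop local power line. Let $\beta_m^l=\beta_l^m\in(0,1)$, $\alpha_b>\alpha_s\ge0$ (unit purchasing and selling prices), $\eta>0$, $P_m^{\mathrm{CIR}}$ and $P_m^{\max}>0$ be constants, $V>0$ a control parameter, $E_m^{\mathrm{HAV}}[k]$ the renewable energy harvested in frame $k$, and $x^+=\max\{x,0\}$. Put $$X_m=\frac1\eta\sum_{n\in\mathcal N_m^{\mathrm{ACT}}[k]}\|\boldsymbol w_{m,n}\|^2+P_m^{\mathrm{CIR}}+\sum_{l\in\mathcal N_m}\max\{\delta_m^l,\beta_m^l\delta_m^l\}-\frac1T E_m^{\mathrm{HAV}}[k],$$ $$G_m^{\mathrm{SG}}=(\alpha_b-\alpha_s)X_m^++\alpha_sX_m.$$ $q^A_{m,n}(t_k)\ge0$ is the access-queue backlog of user $(m,n)$ in slot $t_k$; $q^A_{m,n}[k]$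 and $q^U_{m,n}[k]$ are the access- and processing-queue backlogs at the start of frame $k$. $\Im$ denotes imaginary part. When $f_{m,n}(\phi)=0$, constraint (b) is read after multiplying both sides by $f_{m,n}(\phi)$.
   Formalization: For selling price zero, some optimal solution (not every one, which is false) is shown to have all (b) active; for positive selling price every one does. The ratio constraint on rates is cross-multiplied, since rates and backlogs may vanish. *)

theory Defs
  imports "HOL-Analysis.Analysis"
begin

text \<open>
  The data of one fixed slot of a frame. BSTs are indexed by \<open>1..num_bst\<close>, the users of BST
  \<open>m\<close> by \<open>1..num_user m\<close>, and the antennas of each BST by the finite type \<open>'l\<close>; values of the
  fields outside these ranges play no role. \<open>chan S j m n\<close> is the channel from BST \<open>j\<close> to user
  \<open>(m,n)\<close>, \<open>noise_pow S m n\<close> is the noise power (the square of sigma), \<open>backlog_slot\<close> is the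
  access-queue backlog in the slot, and \<open>backlogA\<close>, \<open>backlogU\<close> are the access- and
  processing-queue backlogs at the start of the frame.
\<close>

record ('l::finite) slot_data =
  num_bst :: nat
  num_user :: "nat \<Rightarrow> nat"
  sched :: "nat \<Rightarrow> nat \<Rightarrow> real"
  chan :: "nat \<Rightarrow> nat \<Rightarrow> nat \<Rightarrow> complex ^ 'l"
  noise_pow :: "nat \<Rightarrow> nat \<Rightarrow> real"
  nbrs :: "nat \<Rightarrow> nat set"
  line_eff :: "nat \<Rightarrow> nat \<Rightarrow> real"
  price_buy :: real
  price_sell :: real
  amp_eff :: real
  p_circ :: "nat \<Rightarrow> real"
  p_max :: "nat \<Rightarrow> real"
  ctrl_V :: real
  harvested :: "nat \<Rightarrow> real"
  num_slots :: nat
  backlog_slot :: "nat \<Rightarrow> nat \<Rightarrow> real"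
  backlogA :: "nat \<Rightarrow> nat \<Rightarrow> real"
  backlogU :: "nat \<Rightarrow> nat \<Rightarrow> real"

type_synonym 'l beams = "nat \<Rightarrow> nat \<Rightarrow> complex ^ 'l"
type_synonym exchange = "nat \<Rightarrow> nat \<Rightarrow> real"

definition bsts :: "('l::finite) slot_data \<Rightarrow> nat set" where
  "bsts S = {1..num_bst S}"

definition users :: "('l::finite) slot_data \<Rightarrow> nat \<Rightarrow> nat set" where
  "users S m = {1..num_user S m}"

definition act :: "('l::finite) slot_data \<Rightarrow> nat \<Rightarrow> nat set" where
  "act S m = {n \<in> users S m. sched S m n = 1}"

definition herm :: "complex ^ 'l \<Rightarrow> complex ^ 'l \<Rightarrow> complex" where
  "herm h w = (\<Sum>i\<in>UNIV. cnj (h $ i) * w $ i)"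

definition intra :: "('l::finite) slot_data \<Rightarrow> 'l beams \<Rightarrow> nat \<Rightarrow> nat \<Rightarrow> real" where
  "intra S w m n =
     (\<Sum>i\<in>users S m - {n}. sched S m i * (cmod (herm (chan S m m n) (w m i)))\<^sup>2)"

definition inter :: "('l::finite) slot_data \<Rightarrow> 'l beams \<Rightarrow> nat \<Rightarrow> nat \<Rightarrow> real" where
  "inter S w m n =
     (\<Sum>j\<in>bsts S - {m}. \<Sum>i\<in>users S j.
        sched S j i * (cmod (herm (chan S j m n) (w j i)))\<^sup>2)"

definition rate :: "('l::finite) slot_data \<Rightarrow> 'l beams \<Rightarrow> nat \<Rightarrow> nat \<Rightarrow> real" where
  "rate S w m n =
     ln (1 + sched S m n * (cmod (herm (chan S m m n) (w m n)))\<^sup>2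
             / (intra S w m n + inter S w m n + noise_pow S m n))"

text \<open>Net energy drawn by BST \<open>m\<close> from the grid (\<open>X\<close>) and its cost (\<open>G\<close>).\<close>

definition net_energy :: "('l::finite) slot_data \<Rightarrow> 'l beams \<Rightarrow> exchange \<Rightarrow> nat \<Rightarrow> real" where
  "net_energy S w \<delta> m =
     1 / amp_eff S * (\<Sum>n\<in>act S m. (norm (w m n))\<^sup>2) + p_circ S m
     + (\<Sum>l\<in>nbrs S m. max (\<delta> m l) (line_eff S m l * \<delta> m l))
     - 1 / real (num_slots S) * harvested S m"

definition grid_cost :: "('l::finite) slot_data \<Rightarrow> 'l beams \<Rightarrow> exchange \<Rightarrow> nat \<Rightarrow> real" where
  "grid_cost S w \<delta> m =
     (price_buy S - price_sell S) * max (net_energy S w \<delta> m) 0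
     + price_sell S * net_energy S w \<delta> m"

definition power_ok :: "('l::finite) slot_data \<Rightarrow> 'l beams \<Rightarrow> bool" where
  "power_ok S w \<longleftrightarrow> (\<forall>m\<in>bsts S. (\<Sum>n\<in>act S m. (norm (w m n))\<^sup>2) \<le> p_max S m)"


text \<open>
  The per-slot problem. The proportionality of the rates,
  \<open>r m n / r j i = q m n / q j i\<close>, is cross-multiplied, since rates and backlogs may vanish
  (and division by zero in HOL returns zero).
\<close>

definition slot_feasible :: "('l::finite) slot_data \<Rightarrow> ('l beams \<times> exchange) set" where
  "slot_feasible S = {(w, \<delta>).
     (\<forall>m\<in>bsts S. \<forall>l\<in>bsts S. \<delta> m l + \<delta> l m = 0) \<and>
     (\<forall>m\<in>bsts S. \<forall>n\<in>users S m. rate S w m n \<le> backlog_slot S m n) \<and>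
     (\<forall>m\<in>bsts S. \<forall>j\<in>bsts S. \<forall>n\<in>act S m. \<forall>i\<in>act S j.
        rate S w m n * backlog_slot S j i = rate S w j i * backlog_slot S m n) \<and>
     power_ok S w}"

definition slot_objective :: "('l::finite) slot_data \<Rightarrow> 'l beams \<times> exchange \<Rightarrow> real" where
  "slot_objective S = (\<lambda>(w, \<delta>).
     (\<Sum>m\<in>bsts S. \<Sum>n\<in>users S m. (backlogU S m n - backlogA S m n) * rate S w m n)
     + ctrl_V S * (\<Sum>m\<in>bsts S. grid_cost S w \<delta> m))"

definition slot_opt :: "('l::finite) slot_data \<Rightarrow> ereal" where
  "slot_opt S = (INF x\<in>slot_feasible S. ereal (slot_objective S x))"


definition f_sinr :: "('l::finite) slot_data \<Rightarrow> real \<Rightarrow> nat \<Rightarrow> nat \<Rightarrow> real" where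
  "f_sinr S \<phi> m n = sqrt (exp (backlog_slot S m n * \<phi>) - 1)"

text \<open>
  Constraint (b) of the relaxed problem and its active version, multiplied by
  \<open>f_sinr S \<phi> m n \<ge> 0\<close>. The inner product is real by constraint (c), hence \<open>Re\<close>.
\<close>

definition sinr_constr ::
    "('l::finite) slot_data \<Rightarrow> real \<Rightarrow> 'l beams \<Rightarrow> nat \<Rightarrow> nat \<Rightarrow> bool" where
  "sinr_constr S \<phi> w m n \<longleftrightarrow>
     Re (herm (chan S m m n) (w m n))
       \<ge> f_sinr S \<phi> m n * sqrt (intra S w m n + inter S w m n + noise_pow S m n)"

definition sinr_active ::
    "('l::finite) slot_data \<Rightarrow> real \<Rightarrow> 'l beams \<Rightarrow> nat \<Rightarrow> nat \<Rightarrow> bool" where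
  "sinr_active S \<phi> w m n \<longleftrightarrow>
     Re (herm (chan S m m n) (w m n))
       = f_sinr S \<phi> m n * sqrt (intra S w m n + inter S w m n + noise_pow S m n)"

definition relaxed_feasible ::
    "('l::finite) slot_data \<Rightarrow> real \<Rightarrow> ('l beams \<times> exchange) set" where
  "relaxed_feasible S \<phi> = {(w, \<delta>).
     (\<forall>m\<in>bsts S. \<delta> m m = 0) \<and>
     (\<forall>m\<in>bsts S. \<forall>l\<in>nbrs S m. \<delta> m l + \<delta> l m = 0) \<and>
     (\<forall>m\<in>bsts S. \<forall>n\<in>act S m. sinr_constr S \<phi> w m n) \<and>
     (\<forall>m\<in>bsts S. \<forall>n\<in>act S m. Im (herm (chan S m m n) (w m n)) = 0) \<and>
     power_ok S w}"

definition relaxed_objective ::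
    "('l::finite) slot_data \<Rightarrow> real \<Rightarrow> 'l beams \<times> exchange \<Rightarrow> real" where
  "relaxed_objective S \<phi> = (\<lambda>(w, \<delta>).
     \<Sum>m\<in>bsts S.
       ctrl_V S * (price_buy S - price_sell S) * max (net_energy S w \<delta> m) 0
       + ctrl_V S * price_sell S * net_energy S w \<delta> m
       + (\<Sum>n\<in>act S m. (backlogU S m n - backlogA S m n) * backlog_slot S m n * \<phi>))"

definition relaxed_optimal ::
    "('l::finite) slot_data \<Rightarrow> real \<Rightarrow> 'l beams \<times> exchange \<Rightarrow> bool" where
  "relaxed_optimal S \<phi> = is_arg_min (relaxed_objective S \<phi>) (\<lambda>x. x \<in> relaxed_feasible S \<phi>)"

text \<open>The value is infinite when the problem is infeasible for the given \<open>\<phi>\<close>.\<close>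

definition relaxed_value :: "('l::finite) slot_data \<Rightarrow> real \<Rightarrow> ereal" where
  "relaxed_value S \<phi> = (INF x\<in>relaxed_feasible S \<phi>. ereal (relaxed_objective S \<phi> x))"

definition relaxed_opt :: "('l::finite) slot_data \<Rightarrow> ereal" where
  "relaxed_opt S = (INF \<phi>\<in>{0..1}. relaxed_value S \<phi>)"

end

(* If (b) is slack at an active user, its beam can be shrunk until (b) is tight; this lowers the
   transmit power and all interference, so it keeps feasibility and never raises the cost (and
   strictly lowers it if the selling price is positive). A feasible point of least power in a
   compact box below a given one is therefore active and at least as good. Optima exist although
   the exchanged energies range over an unbounded set: a transfer over a lossy line is paid for
   at a rate proportional to its size, which makes the cost coercive. Under active (b) the rate of
   every scheduled user is q * phi, so active points are feasible for the per-slot problem with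
   the same cost; conversely proportional rates define phi, and rotating each beam by a phase
   makes (c) hold. *)

theory Submission
  imports Defs
begin

section \<open>Compact and closed sets in function spaces\<close>

text \<open>Tychonoff's theorem: the function type carries the product topology and the set is a
  full product. Beams and exchanges are functions on all of \<open>nat\<close>, so infinitely many
  factors occur.\<close>

lemma compact_fun_box:
  fixes K :: "'i \<Rightarrow> 'b::topological_space set"
  assumes "\<And>i. compact (K i)"
  shows "compact {f. \<forall>i. f i \<in> K i}"
proof -
  have "{f. \<forall>i. f i \<in> K i} = PiE UNIV K"
    by (auto simp: PiE_def Pi_def)
  then show ?thesis
    using compactin_PiE[of "\<lambda>i. euclidean" UNIV K] assms
    by (simp add: euclidean_product_topology)
qed

lemma compact_fun2_box:
  fixes K :: "'i \<Rightarrow> 'j \<Rightarrow> 'b::topological_space set"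
  assumes "\<And>i j. compact (K i j)"
  shows "compact {f. \<forall>i j. f i j \<in> K i j}"
  using compact_fun_box[of "\<lambda>i. {g. \<forall>j. g j \<in> K i j}"] compact_fun_box[of "K _"] assms
  by simp

lemma closed_Collect_ball:
  assumes "\<And>i. i \<in> A \<Longrightarrow> closed {x. P i x}"
  shows "closed {x. \<forall>i\<in>A. P i x}"
  using assms by (auto simp: Collect_ball_eq)

section \<open>Hermitian products and continuity of the problem data\<close>

lemma herm_smult: "herm h (c *s w) = c * herm h w"
  by (simp add: herm_def sum_distrib_left mult_ac)

lemma herm_zero: "herm h 0 = 0"
  by (simp add: herm_def)

lemma norm_smult_complex: "norm (c *s (w :: complex ^ 'l)) = cmod c * norm w"
  by (simp add: norm_vec_def norm_mult L2_set_right_distrib)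

lemma continuous_on_herm [continuous_intros]:
  assumes "continuous_on A f"
  shows "continuous_on A (\<lambda>x. herm h (f x))"
  unfolding herm_def using assms by (intro continuous_intros)

text \<open>The denominator of the SINR. The other users' beams enter (b) and the rate of a user
  only through this quantity.\<close>

definition disturbance :: "('l::finite) slot_data \<Rightarrow> 'l beams \<Rightarrow> nat \<Rightarrow> nat \<Rightarrow> real" where
  "disturbance S w m n = intra S w m n + inter S w m n + noise_pow S m n"

lemma continuous_on_disturbance:
  assumes "\<And>m n. continuous_on A (\<lambda>x. w x m n)"
  shows "continuous_on A (\<lambda>x. disturbance S (w x) m n)"
  unfolding disturbance_def intra_def inter_def by (intro continuous_intros assms)

lemma continuous_on_net_energy:
  assumes "\<And>m n. continuous_on A (\<lambda>x. w x m n)" "\<And>m l. continuous_on A (\<lambda>x. \<delta> x m l)"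
  shows "continuous_on A (\<lambda>x. net_energy S (w x) (\<delta> x) m)"
  unfolding net_energy_def by (intro continuous_intros assms)

lemma continuous_on_coord2:
  assumes "continuous_on A f"
  shows "continuous_on A (\<lambda>x. f x i j)"
  by (rule continuous_on_product_then_coordinatewise, rule continuous_on_product_then_coordinatewise)
    (rule assms)

lemma continuous_on_beam: "continuous_on A (\<lambda>p. fst (snd p) m n)"
  by (rule continuous_on_coord2) (intro continuous_on_fst continuous_on_snd continuous_on_id)

lemma continuous_on_exchange: "continuous_on A (\<lambda>p. snd (snd p) m l)"
  by (rule continuous_on_coord2) (intro continuous_on_snd continuous_on_id)

lemma continuous_on_relaxed_objective:
  "continuous_on A (\<lambda>p. relaxed_objective S (fst p) (snd p))"
  unfolding relaxed_objective_def case_prod_beta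
  by (intro continuous_intros continuous_on_net_energy continuous_on_beam continuous_on_exchange)

text \<open>Closedness is joint in \<phi>, beams and exchanges, so that \<phi> can be minimized over
  together with them. Every constraint is an equation or a non-strict inequality between continuous
  functions.\<close>

lemma closed_relaxed_feasible:
  "closed {p. snd p \<in> relaxed_feasible S (fst p)}"
  unfolding relaxed_feasible_def case_prod_beta mem_Collect_eq sinr_constr_def power_ok_def
    f_sinr_def disturbance_def[symmetric]
  by (intro closed_Collect_conj closed_Collect_ball closed_Collect_le closed_Collect_eq
        continuous_on_disturbance continuous_on_beam continuous_on_exchange continuous_intros)

text \<open>For fixed \<phi> the second summand is constant, so only the grid cost has to be
  compared.\<close>

lemma relaxed_objective_eq:
  "relaxed_objective S \<phi> (w, \<delta>) = ctrl_V S * (\<Sum>m\<in>bsts S. grid_cost S w \<delta> m)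
     + \<phi> * (\<Sum>m\<in>bsts S. \<Sum>n\<in>act S m. (backlogU S m n - backlogA S m n) * backlog_slot S m n)"
  by (simp add: relaxed_objective_def grid_cost_def sum.distrib sum_distrib_left
      distrib_left mult.assoc mult.left_commute mult.commute[of _ \<phi>])

lemma finite_bsts [simp]: "finite (bsts S)" by (simp add: bsts_def)
lemma finite_users [simp]: "finite (users S m)" by (simp add: users_def)
lemma finite_act [simp]: "finite (act S m)" by (simp add: act_def)

locale slot_problem =
  fixes S :: "('l::finite) slot_data"
  assumes sched_01: "\<And>m n. m \<in> bsts S \<Longrightarrow> n \<in> users S m \<Longrightarrow> sched S m n \<in> {0, 1}"
    and noise_pos: "\<And>m n. m \<in> bsts S \<Longrightarrow> n \<in> users S m \<Longrightarrow> noise_pow S m n > 0"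
    and nbrs_subset: "\<And>m. m \<in> bsts S \<Longrightarrow> nbrs S m \<subseteq> bsts S - {m}"
    and nbrs_sym: "\<And>m l. m \<in> bsts S \<Longrightarrow> l \<in> nbrs S m \<Longrightarrow> m \<in> nbrs S l"
    and line_eff: "\<And>m l. m \<in> bsts S \<Longrightarrow> l \<in> nbrs S m \<Longrightarrow>
           line_eff S m l = line_eff S l m \<and> 0 < line_eff S m l \<and> line_eff S m l < 1"
    and prices: "price_buy S > price_sell S" "price_sell S \<ge> 0"
    and amp_pos: "amp_eff S > 0"
    and p_max_pos: "\<And>m. m \<in> bsts S \<Longrightarrow> p_max S m > 0"
    and V_pos: "ctrl_V S > 0"
    and backlog_nonneg: "\<And>m n. m \<in> bsts S \<Longrightarrow> n \<in> users S m \<Longrightarrow> backlog_slot S m n \<ge> 0"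
begin

section \<open>Interference as a function of the scheduled beams\<close>

lemma act_subset: "n \<in> act S m \<Longrightarrow> n \<in> users S m"
  by (simp add: act_def)

lemma finite_nbrs: "m \<in> bsts S \<Longrightarrow> finite (nbrs S m)"
  using nbrs_subset finite_subset by fastforce

lemma intra_eq_sum_act:
  assumes "m \<in> bsts S"
  shows "intra S w m n = (\<Sum>i\<in>act S m - {n}. (cmod (herm (chan S m m n) (w m i)))\<^sup>2)"
  unfolding intra_def
  by (rule sum.mono_neutral_cong_right) (use sched_01[OF assms] in \<open>auto simp: act_def\<close>)

lemma inter_eq_sum_act:
  "inter S w m n =
     (\<Sum>j\<in>bsts S - {m}. \<Sum>i\<in>act S j. (cmod (herm (chan S j m n) (w j i)))\<^sup>2)"
  unfolding inter_def
  by (intro sum.cong refl sum.mono_neutral_cong_right) (use sched_01 in \<open>auto simp: act_def\<close>)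

lemma disturbance_pos:
  assumes "m \<in> bsts S" "n \<in> users S m"
  shows "disturbance S w m n > 0"
proof -
  have "intra S w m n \<ge> 0" "inter S w m n \<ge> 0"
    using assms by (auto simp: intra_eq_sum_act inter_eq_sum_act intro!: sum_nonneg)
  then show ?thesis
    using noise_pos[OF assms] by (simp add: disturbance_def)
qed

text \<open>A user's own beam is not part of its interference, hence the exception for
  \<open>(m, n)\<close>.\<close>

lemma disturbance_mono:
  assumes "m \<in> bsts S"
    and "\<And>j i. j \<in> bsts S \<Longrightarrow> i \<in> act S j \<Longrightarrow> (j, i) \<noteq> (m, n) \<Longrightarrow>
           cmod (herm (chan S j m n) (v j i)) \<le> cmod (herm (chan S j m n) (w j i))"
  shows "disturbance S v m n \<le> disturbance S w m n"
  unfolding disturbance_def intra_eq_sum_act[OF assms(1)] inter_eq_sum_act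
  by (intro add_mono order_refl sum_mono power_mono assms(2)) (use assms(1) in auto)

lemma disturbance_cong:
  assumes "m \<in> bsts S"
    and "\<And>j i. j \<in> bsts S \<Longrightarrow> i \<in> act S j \<Longrightarrow> (j, i) \<noteq> (m, n) \<Longrightarrow>
           cmod (herm (chan S j m n) (v j i)) = cmod (herm (chan S j m n) (w j i))"
  shows "disturbance S v m n = disturbance S w m n"
  by (intro antisym disturbance_mono assms(1)) (simp_all add: assms(2))

lemma f_sinr_nonneg:
  assumes "m \<in> bsts S" "n \<in> users S m" "0 \<le> \<phi>"
  shows "0 \<le> f_sinr S \<phi> m n" "(f_sinr S \<phi> m n)\<^sup>2 = exp (backlog_slot S m n * \<phi>) - 1"
  using backlog_nonneg[OF assms(1,2)] assms(3) by (simp_all add: f_sinr_def)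

section \<open>Monotonicity of the cost in the transmit power\<close>

lemma grid_cost_mono:
  assumes "net_energy S v \<epsilon> m \<le> net_energy S w \<delta> m"
  shows "grid_cost S v \<epsilon> m \<le> grid_cost S w \<delta> m"
  unfolding grid_cost_def using prices assms
  by (intro add_mono mult_left_mono max.mono) auto

text \<open>The positive part is flat where net energy is negative; strictness comes from the term
  with \<open>price_sell S\<close>.\<close>

lemma grid_cost_strict_mono:
  assumes "price_sell S > 0" "net_energy S v \<epsilon> m < net_energy S w \<delta> m"
  shows "grid_cost S v \<epsilon> m < grid_cost S w \<delta> m"
  unfolding grid_cost_def using prices assms
  by (intro add_le_less_mono mult_left_mono mult_strict_left_mono max.mono) auto

lemma net_energy_mono:
  assumes "(\<Sum>n\<in>act S m. (norm (v m n))\<^sup>2) \<le> (\<Sum>n\<in>act S m. (norm (w m n))\<^sup>2)"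
  shows "net_energy S v \<delta> m \<le> net_energy S w \<delta> m"
  unfolding net_energy_def using assms amp_pos by (simp add: divide_right_mono)

lemma net_energy_strict_mono:
  assumes "(\<Sum>n\<in>act S m. (norm (v m n))\<^sup>2) < (\<Sum>n\<in>act S m. (norm (w m n))\<^sup>2)"
  shows "net_energy S v \<delta> m < net_energy S w \<delta> m"
  unfolding net_energy_def using assms amp_pos by (simp add: divide_strict_right_mono)

lemma relaxed_objective_mono:
  assumes "\<And>m n. norm (v m n) \<le> norm (w m n)"
  shows "relaxed_objective S \<phi> (v, \<delta>) \<le> relaxed_objective S \<phi> (w, \<delta>)"
  unfolding relaxed_objective_eq using V_pos assms
  by (intro add_right_mono mult_left_mono sum_mono grid_cost_mono net_energy_mono power_mono) auto

lemma power_sum_strict_mono: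
  assumes "\<And>j i. norm (v j i) \<le> norm (w j i)" "n \<in> act S m" "norm (v m n) < norm (w m n)"
  shows "(\<Sum>n\<in>act S m. (norm (v m n))\<^sup>2) < (\<Sum>n\<in>act S m. (norm (w m n))\<^sup>2)"
  by (rule sum_strict_mono_ex1) (use assms in \<open>auto intro!: power_mono power_strict_mono\<close>)

section \<open>Shrinking beams until the SINR constraints are tight\<close>

text \<open>A user with slack in (b) can have its beam shrunk until (b) is tight: its own signal
  does not enter its own interference, and the interference of every other user only drops.\<close>

lemma shrink_slack_beam:
  assumes feas: "(w, \<delta>) \<in> relaxed_feasible S \<phi>" and \<phi>: "0 \<le> \<phi>"
    and mn: "m \<in> bsts S" "n \<in> act S m" and slack: "\<not> sinr_active S \<phi> w m n"
  obtains v where "(v, \<delta>) \<in> relaxed_feasible S \<phi>" "\<And>j i. norm (v j i) \<le> norm (w j i)"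
    "norm (v m n) < norm (w m n)"
proof -
  define need where "need = f_sinr S \<phi> m n * sqrt (disturbance S w m n)"
  define R where "R = Re (herm (chan S m m n) (w m n))"
  \<comment> \<open>The factor that scales the received signal \<open>R\<close> down to exactly the
    required level. Slack means \<open>R > need\<close>, and \<open>need\<close> is nonnegative, so
    the factor lies in \<open>[0, 1)\<close>.\<close>
  define t where "t = need / R"
  define v where "v = w(m := (w m)(n := complex_of_real t *s w m n))"
  have nu: "n \<in> users S m" using mn by (simp add: act_subset)
  have need0: "0 \<le> need"
    unfolding need_def using f_sinr_nonneg[OF mn(1) nu \<phi>] disturbance_pos[OF mn(1) nu, of w]
    by simp
  have needR: "need < R"
    using feas mn slack
    by (fastforce simp: relaxed_feasible_def sinr_constr_def sinr_active_def need_def R_def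
        disturbance_def)
  have t: "0 \<le> t" "t < 1" "t * R = need"
    using need0 needR by (auto simp: t_def)
  \<comment> \<open>A zero beam would give \<open>R = 0\<close>, contradicting
    \<open>R > need\<close>. A nonzero beam gets strictly shorter.\<close>
  have "w m n \<noteq> 0"
    using need0 needR by (auto simp: R_def herm_zero)
  have v_mn: "v m n = complex_of_real t *s w m n" and v_other: "(j, i) \<noteq> (m, n) \<Longrightarrow> v j i = w j i"
    for j i by (auto simp: v_def)
  have norm_le: "norm (v j i) \<le> norm (w j i)" for j i
    using t v_mn v_other[of j i]
    by (cases "(j, i) = (m, n)") (auto simp: norm_smult_complex intro: mult_left_le_one_le)
  have herm_le: "cmod (herm h (v j i)) \<le> cmod (herm h (w j i))" for h j i
    using t v_mn v_other[of j i]
    by (cases "(j, i) = (m, n)") (auto simp: herm_smult norm_mult intro: mult_left_le_one_le)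
  have "norm (v m n) < norm (w m n)"
    using t \<open>w m n \<noteq> 0\<close> by (simp add: v_mn norm_smult_complex)
  moreover have "(v, \<delta>) \<in> relaxed_feasible S \<phi>"
  proof -
    have "sinr_constr S \<phi> v j i" if ji: "j \<in> bsts S" "i \<in> act S j" for j i
    proof (cases "(j, i) = (m, n)")
      case True
      have "disturbance S v m n = disturbance S w m n"
        by (rule disturbance_cong[OF mn(1)]) (use v_other in auto)
      then show ?thesis
        using True t by (simp add: sinr_constr_def v_mn herm_smult R_def need_def disturbance_def)
    next
      case False
      have "f_sinr S \<phi> j i * sqrt (disturbance S v j i) \<le> f_sinr S \<phi> j i * sqrt (disturbance S w j i)"
        by (intro mult_left_mono real_sqrt_le_mono disturbance_mono herm_le f_sinr_nonneg
            act_subset ji \<phi>)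
      also have "\<dots> \<le> Re (herm (chan S j j i) (w j i))"
        using feas ji by (auto simp: relaxed_feasible_def sinr_constr_def disturbance_def)
      finally show ?thesis
        using v_other[OF False] by (simp add: sinr_constr_def disturbance_def)
    qed
    moreover have "Im (herm (chan S j j i) (v j i)) = 0" if "j \<in> bsts S" "i \<in> act S j" for j i
      using feas that v_mn v_other[of j i]
      by (cases "(j, i) = (m, n)") (auto simp: relaxed_feasible_def herm_smult)
    moreover have "power_ok S v"
      unfolding power_ok_def
    proof
      fix j assume j: "j \<in> bsts S"
      have "(\<Sum>n\<in>act S j. (norm (v j n))\<^sup>2) \<le> (\<Sum>n\<in>act S j. (norm (w j n))\<^sup>2)"
        by (intro sum_mono power_mono norm_le) auto
      with feas j show "(\<Sum>n\<in>act S j. (norm (v j n))\<^sup>2) \<le> p_max S j"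
        by (fastforce simp: relaxed_feasible_def power_ok_def)
    qed
    ultimately show ?thesis
      using feas by (auto simp: relaxed_feasible_def)
  qed
  ultimately show ?thesis
    using that norm_le by blast
qed

text \<open>Shrinking a slack beam strictly lowers the power, hence the net energy, of its BST; at a
  positive selling price this strictly lowers the cost, against optimality.\<close>

lemma relaxed_optimal_imp_active:
  assumes "price_sell S > 0" "0 \<le> \<phi>" and opt: "relaxed_optimal S \<phi> (w, \<delta>)"
    and mn: "m \<in> bsts S" "n \<in> act S m"
  shows "sinr_active S \<phi> w m n"
proof (rule ccontr)
  assume slack: "\<not> sinr_active S \<phi> w m n"
  have "(w, \<delta>) \<in> relaxed_feasible S \<phi>"
    using opt by (simp add: relaxed_optimal_def is_arg_min_def)
  from shrink_slack_beam[OF this assms(2) mn slack]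
  obtain v where v: "(v, \<delta>) \<in> relaxed_feasible S \<phi>" "\<And>j i. norm (v j i) \<le> norm (w j i)"
    "norm (v m n) < norm (w m n)" by blast
  have "(\<Sum>m\<in>bsts S. grid_cost S v \<delta> m) < (\<Sum>m\<in>bsts S. grid_cost S w \<delta> m)"
  proof (rule sum_strict_mono_ex1)
    show "\<forall>m\<in>bsts S. grid_cost S v \<delta> m \<le> grid_cost S w \<delta> m"
      by (intro ballI grid_cost_mono net_energy_mono sum_mono power_mono v) auto
    show "\<exists>m\<in>bsts S. grid_cost S v \<delta> m < grid_cost S w \<delta> m"
      using mn v
      by (intro bexI[of _ m] grid_cost_strict_mono net_energy_strict_mono power_sum_strict_mono
          assms(1)) auto
  qed simp
  then have "relaxed_objective S \<phi> (v, \<delta>) < relaxed_objective S \<phi> (w, \<delta>)"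
    using V_pos by (simp add: relaxed_objective_eq)
  with opt v show False
    by (auto simp: relaxed_optimal_def is_arg_min_def)
qed

text \<open>Shrinking one beam can open slack at other users, so it is not iterated: the total power
  is minimized once, with the exchanges held fixed. Unlike the cost, the power drops strictly under
  shrinking even if \<open>price_sell S = 0\<close>.\<close>

lemma dominated_by_active:
  assumes feas: "(w, \<delta>) \<in> relaxed_feasible S \<phi>" and \<phi>: "0 \<le> \<phi>"
  obtains v where "(v, \<delta>) \<in> relaxed_feasible S \<phi>"
    "relaxed_objective S \<phi> (v, \<delta>) \<le> relaxed_objective S \<phi> (w, \<delta>)"
    "\<And>m n. m \<in> bsts S \<Longrightarrow> n \<in> act S m \<Longrightarrow> sinr_active S \<phi> v m n"
proof -
  \<comment> \<open>Every coordinate is bounded, unscheduled ones included, since compactness in the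
    product topology needs it.\<close>
  define K where "K = {v :: 'l beams. \<forall>m n. v m n \<in> cball 0 (norm (w m n))}"
  define F where "F = {v. (v, \<delta>) \<in> relaxed_feasible S \<phi>}"
  define pow where "pow = (\<lambda>v :: 'l beams. \<Sum>m\<in>bsts S. \<Sum>n\<in>act S m. (norm (v m n))\<^sup>2)"
  have "closed ((\<lambda>v. (\<phi>, v, \<delta>)) -` {p. snd p \<in> relaxed_feasible S (fst p)})"
    by (intro closed_vimage closed_relaxed_feasible continuous_intros)
  moreover have "(\<lambda>v. (\<phi>, v, \<delta>)) -` {p. snd p \<in> relaxed_feasible S (fst p)} = F"
    by (auto simp: F_def)
  moreover have "compact K"
    unfolding K_def by (rule compact_fun2_box) simp
  ultimately have "compact (K \<inter> F)"
    by (metis compact_Int_closed)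
  moreover have "K \<inter> F \<noteq> {}"
    using feas by (auto simp: K_def F_def)
  moreover have "continuous_on (K \<inter> F) pow"
    unfolding pow_def by (intro continuous_intros continuous_on_coord2[OF continuous_on_id])
  ultimately obtain v where v: "v \<in> K \<inter> F" and min: "\<And>u. u \<in> K \<inter> F \<Longrightarrow> pow v \<le> pow u"
    using continuous_attains_inf by metis
  have norm_le: "norm (v m n) \<le> norm (w m n)" for m n
    using v by (simp add: K_def)
  have "sinr_active S \<phi> v m n" if mn: "m \<in> bsts S" "n \<in> act S m" for m n
  proof (rule ccontr)
    assume "\<not> sinr_active S \<phi> v m n"
    then obtain u where u: "(u, \<delta>) \<in> relaxed_feasible S \<phi>" "\<And>j i. norm (u j i) \<le> norm (v j i)"
      "norm (u m n) < norm (v m n)"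
      using shrink_slack_beam[OF _ \<phi> mn, of v \<delta>] v by (auto simp: F_def)
    have "pow u < pow v"
      unfolding pow_def
    proof (rule sum_strict_mono_ex1)
      show "\<forall>m\<in>bsts S. (\<Sum>n\<in>act S m. (norm (u m n))\<^sup>2) \<le> (\<Sum>n\<in>act S m. (norm (v m n))\<^sup>2)"
        by (intro ballI sum_mono power_mono u) auto
      show "\<exists>m\<in>bsts S. (\<Sum>n\<in>act S m. (norm (u m n))\<^sup>2) < (\<Sum>n\<in>act S m. (norm (v m n))\<^sup>2)"
        using power_sum_strict_mono[of u v, OF u(2) mn(2) u(3)] mn(1) by blast
    qed simp
    moreover have "u \<in> K \<inter> F"
      using u(1) order_trans[OF u(2) norm_le] by (simp add: K_def F_def)
    ultimately show False
      using min by fastforce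
  qed
  then show ?thesis
    using that v relaxed_objective_mono[OF norm_le] by (auto simp: F_def)
qed

section \<open>Line losses and coercivity in the exchanged energies\<close>

text \<open>Sending \<open>\<delta>\<close> over a line costs \<open>(1 - \<beta>) \<bar>\<delta>\<bar>\<close> when both ends are added up.\<close>

lemma sum_line_loss:
  assumes anti: "\<And>m l. m \<in> bsts S \<Longrightarrow> l \<in> nbrs S m \<Longrightarrow> \<delta> m l + \<delta> l m = 0"
  shows "2 * (\<Sum>m\<in>bsts S. \<Sum>l\<in>nbrs S m. max (\<delta> m l) (line_eff S m l * \<delta> m l))
       = (\<Sum>m\<in>bsts S. \<Sum>l\<in>nbrs S m. (1 - line_eff S m l) * \<bar>\<delta> m l\<bar>)"
proof -
  define Q where "Q = Sigma (bsts S) (nbrs S)"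
  define g where "g = (\<lambda>m l. max (\<delta> m l) (line_eff S m l * \<delta> m l))"
  have sum_Q: "(\<Sum>m\<in>bsts S. \<Sum>l\<in>nbrs S m. h m l) = (\<Sum>(m, l)\<in>Q. h m l)" for h :: "nat \<Rightarrow> nat \<Rightarrow> real"
    unfolding Q_def by (rule sum.Sigma) (auto simp: finite_nbrs)
  \<comment> \<open>Lines are symmetric, so each ordered pair can be matched with its reverse and
    the two ends of a line added up.\<close>
  have "prod.swap ` Q = Q"
    unfolding Q_def using nbrs_subset nbrs_sym by force
  then have "(\<Sum>(m, l)\<in>Q. g m l) = (\<Sum>(m, l)\<in>Q. g l m)"
    by (intro sum.reindex_bij_betw[of prod.swap Q Q "\<lambda>(m, l). g l m", symmetric, THEN trans]
        sum.reindex_bij_betw[of prod.swap Q Q "\<lambda>(m, l). g m l", symmetric, THEN trans])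
      (auto simp: bij_betw_def case_prod_beta)
  then have "2 * (\<Sum>(m, l)\<in>Q. g m l) = (\<Sum>(m, l)\<in>Q. g m l + g l m)"
    by (simp add: case_prod_beta sum.distrib)
  also have "\<dots> = (\<Sum>(m, l)\<in>Q. (1 - line_eff S m l) * \<bar>\<delta> m l\<bar>)"
  proof (rule sum.cong[OF refl], clarify)
    fix m l assume "(m, l) \<in> Q"
    then have ml: "m \<in> bsts S" "l \<in> nbrs S m" by (auto simp: Q_def)
    have "line_eff S l m = line_eff S m l" "0 < line_eff S m l" "line_eff S m l < 1"
      using line_eff[OF ml] by auto
    moreover have "\<delta> l m = - \<delta> m l"
      using anti[OF ml] by simp
    moreover have "max x (b * x) + max (- x) (b * (- x)) = (1 - b) * \<bar>x\<bar>" if "b < 1" for b x :: real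
    proof (cases "0 \<le> x")
      case True
      then have "b * x \<le> x" using that mult_right_mono[of b 1 x] by simp
      then show ?thesis using True by (simp add: algebra_simps)
    next
      case False
      then have "x \<le> b * x" using that mult_right_mono_neg[of b 1 x] by simp
      then show ?thesis using False by (simp add: algebra_simps)
    qed
    ultimately show "g m l + g l m = (1 - line_eff S m l) * \<bar>\<delta> m l\<bar>"
      by (simp add: g_def)
  qed
  finally show ?thesis
    by (simp add: sum_Q g_def)
qed

text \<open>The cost of a BST is at least \<open>price_buy S\<close> times its net energy, so a
  bound on the objective bounds the total net energy. There the exchanges survive only as line
  losses, each nonnegative and proportional to the size of the transfer.\<close>

lemma exchange_bounded:
  obtains B where "\<And>\<phi> w \<delta> m l. \<phi> \<in> {0..1} \<Longrightarrow> (w, \<delta>) \<in> relaxed_feasible S \<phi> \<Longrightarrow>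
    relaxed_objective S \<phi> (w, \<delta>) \<le> c \<Longrightarrow> m \<in> bsts S \<Longrightarrow> l \<in> nbrs S m \<Longrightarrow> \<bar>\<delta> m l\<bar> \<le> B m l"
proof -
  \<comment> \<open>\<open>A\<close> is the coefficient of \<phi> in the objective, \<open>D\<close>
    the part of the total net energy fixed by the data, and \<open>q\<close> an upper bound for the
    total net energy, uniform in \<phi>.\<close>
  define A where
    "A = (\<Sum>m\<in>bsts S. \<Sum>n\<in>act S m. (backlogU S m n - backlogA S m n) * backlog_slot S m n)"
  define D where "D = (\<Sum>m\<in>bsts S. p_circ S m - 1 / real (num_slots S) * harvested S m)"
  define Vb where "Vb = ctrl_V S * price_buy S"
  define q where "q = (c + \<bar>A\<bar>) / Vb"
  define B where "B = (\<lambda>m l. 2 * (q - D) / (1 - line_eff S m l))"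
  have Vb: "Vb > 0" using V_pos prices by (simp add: Vb_def)
  have "\<bar>\<delta> m l\<bar> \<le> B m l"
    if \<phi>: "\<phi> \<in> {0..1}" and feas: "(w, \<delta>) \<in> relaxed_feasible S \<phi>"
      and obj: "relaxed_objective S \<phi> (w, \<delta>) \<le> c" and ml: "m \<in> bsts S" "l \<in> nbrs S m"
    for \<phi> w \<delta> m l
  proof -
    have \<beta>: "line_eff S j i < 1" if "j \<in> bsts S" "i \<in> nbrs S j" for j i
      using line_eff[OF that] by simp
    define loss where "loss = (\<lambda>m l. (1 - line_eff S m l) * \<bar>\<delta> m l\<bar>)"
    have loss0: "0 \<le> loss j i" if "j \<in> bsts S" "i \<in> nbrs S j" for j i
      using \<beta>[OF that] by (simp add: loss_def)
    have "loss m l \<le> (\<Sum>l\<in>nbrs S m. loss m l)"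
      using ml loss0 by (intro member_le_sum) (auto simp: finite_nbrs)
    also have "\<dots> \<le> (\<Sum>m\<in>bsts S. \<Sum>l\<in>nbrs S m. loss m l)"
      using ml loss0 by (intro member_le_sum[of m _ "\<lambda>m. \<Sum>l\<in>nbrs S m. loss m l"])
        (auto intro: sum_nonneg)
    also have "\<dots> = 2 * (\<Sum>m\<in>bsts S. \<Sum>l\<in>nbrs S m. max (\<delta> m l) (line_eff S m l * \<delta> m l))"
      unfolding loss_def using feas
      by (intro sum_line_loss[symmetric]) (auto simp: relaxed_feasible_def)
    finally have "loss m l / 2 \<le> (\<Sum>m\<in>bsts S. \<Sum>l\<in>nbrs S m. max (\<delta> m l) (line_eff S m l * \<delta> m l))"
      by simp
    moreover have "D + (\<Sum>m\<in>bsts S. \<Sum>l\<in>nbrs S m. max (\<delta> m l) (line_eff S m l * \<delta> m l))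
        \<le> (\<Sum>m\<in>bsts S. net_energy S w \<delta> m)"
      unfolding D_def sum.distrib[symmetric]
    proof (rule sum_mono)
      fix j assume "j \<in> bsts S"
      have "0 \<le> 1 / amp_eff S * (\<Sum>n\<in>act S j. (norm (w j n))\<^sup>2)"
        using amp_pos by (intro mult_nonneg_nonneg sum_nonneg) auto
      then show "p_circ S j - 1 / real (num_slots S) * harvested S j
          + (\<Sum>l\<in>nbrs S j. max (\<delta> j l) (line_eff S j l * \<delta> j l)) \<le> net_energy S w \<delta> j"
        by (simp add: net_energy_def)
    qed
    ultimately have "Vb * (D + loss m l / 2) \<le> Vb * (\<Sum>m\<in>bsts S. net_energy S w \<delta> m)"
      using Vb by (intro mult_left_mono) auto
    also have "\<dots> \<le> ctrl_V S * (\<Sum>m\<in>bsts S. grid_cost S w \<delta> m)"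
    proof -
      have "price_buy S * net_energy S w \<delta> j \<le> grid_cost S w \<delta> j" for j
        using mult_left_mono[of "net_energy S w \<delta> j" "max (net_energy S w \<delta> j) 0"
            "price_buy S - price_sell S"] prices
        by (simp add: grid_cost_def left_diff_distrib)
      then have "price_buy S * (\<Sum>m\<in>bsts S. net_energy S w \<delta> m) \<le> (\<Sum>m\<in>bsts S. grid_cost S w \<delta> m)"
        by (simp add: sum_distrib_left sum_mono)
      then show ?thesis
        using V_pos by (simp add: Vb_def mult.assoc)
    qed
    also have "\<dots> \<le> c + \<bar>A\<bar>"
    proof -
      have "\<bar>\<phi> * A\<bar> \<le> \<bar>A\<bar>"
        using \<phi> by (simp add: abs_mult mult_left_le_one_le)
      then show ?thesis
        using obj unfolding relaxed_objective_eq A_def[symmetric] by linarith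
    qed
    finally have "D + loss m l / 2 \<le> q"
      using Vb by (simp add: q_def pos_le_divide_eq mult.commute)
    then have "loss m l \<le> 2 * (q - D)"
      by simp
    then show ?thesis
      using \<beta>[OF ml] by (simp add: B_def loss_def pos_le_divide_eq mult.commute)
  qed
  then show ?thesis using that by blast
qed

section \<open>Existence of minimizers\<close>

text \<open>Coordinates that no constraint controls are set to zero; this is what makes
  compactness arguments possible.\<close>

definition trim_beams :: "'l beams \<Rightarrow> 'l beams" where
  "trim_beams w = (\<lambda>m n. if m \<in> bsts S \<and> n \<in> act S m then w m n else 0)"

definition trim_exchange :: "exchange \<Rightarrow> exchange" where
  "trim_exchange \<delta> = (\<lambda>m l. if m \<in> bsts S \<and> l \<in> nbrs S m then \<delta> m l else 0)"

lemma net_energy_trim: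
  assumes "m \<in> bsts S"
  shows "net_energy S (trim_beams w) \<delta> m = net_energy S w \<delta> m"
    and "net_energy S w (trim_exchange \<delta>) m = net_energy S w \<delta> m"
  using assms by (simp_all add: net_energy_def trim_beams_def trim_exchange_def)

lemma relaxed_objective_trim:
  "relaxed_objective S \<phi> (trim_beams w, trim_exchange \<delta>) = relaxed_objective S \<phi> (w, \<delta>)"
  by (simp add: relaxed_objective_def net_energy_trim)

lemma disturbance_trim:
  assumes "m \<in> bsts S"
  shows "disturbance S (trim_beams w) m n = disturbance S w m n"
  by (rule disturbance_cong[OF assms]) (simp add: trim_beams_def)

text \<open>The per-slot problem demands antisymmetry for all pairs of BSTs, the relaxed one only
  along power lines. Zeroing the remaining pairs bridges the gap.\<close>

lemma trim_exchange_antisym: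
  assumes "\<And>m l. m \<in> bsts S \<Longrightarrow> l \<in> nbrs S m \<Longrightarrow> \<delta> m l + \<delta> l m = 0"
    and "m \<in> bsts S" "l \<in> bsts S"
  shows "trim_exchange \<delta> m l + trim_exchange \<delta> l m = 0"
  using assms nbrs_sym by (auto simp: trim_exchange_def)

lemma relaxed_feasible_trim:
  assumes feas: "(w, \<delta>) \<in> relaxed_feasible S \<phi>"
  shows "(trim_beams w, trim_exchange \<delta>) \<in> relaxed_feasible S \<phi>"
proof -
  have beam: "trim_beams w m n = w m n" if "m \<in> bsts S" "n \<in> act S m" for m n
    using that by (simp add: trim_beams_def)
  have "trim_exchange \<delta> m m = 0" if "m \<in> bsts S" for m
    using that nbrs_subset by (auto simp: trim_exchange_def)
  moreover have "trim_exchange \<delta> m l + trim_exchange \<delta> l m = 0" if "m \<in> bsts S" "l \<in> nbrs S m" for m l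
    using that nbrs_subset feas
    by (intro trim_exchange_antisym) (auto simp: relaxed_feasible_def)
  moreover have "sinr_constr S \<phi> (trim_beams w) m n" if "m \<in> bsts S" "n \<in> act S m" for m n
    using feas that disturbance_trim[OF that(1), of w n]
    by (auto simp: relaxed_feasible_def sinr_constr_def beam disturbance_def)
  ultimately show ?thesis
    using feas by (auto simp: relaxed_feasible_def power_ok_def beam)
qed

text \<open>Weierstrass on triples of \<phi>, beams and exchanges. \<open>\<Phi>\<close> is a
  singleton when \<phi> is given, and \<open>{0..1}\<close> when \<phi> is optimized as
  well.\<close>

lemma relaxed_attains_min:
  assumes \<Phi>: "compact \<Phi>" "\<Phi> \<subseteq> {0..1}" and \<phi>0: "\<phi>0 \<in> \<Phi>" "(w0, \<delta>0) \<in> relaxed_feasible S \<phi>0"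
  obtains \<phi> w \<delta> where "\<phi> \<in> \<Phi>" "(w, \<delta>) \<in> relaxed_feasible S \<phi>"
    "\<And>\<psi> y. \<psi> \<in> \<Phi> \<Longrightarrow> y \<in> relaxed_feasible S \<psi> \<Longrightarrow>
       relaxed_objective S \<phi> (w, \<delta>) \<le> relaxed_objective S \<psi> y"
proof -
  \<comment> \<open>Only points at least as good as the given one matter, and their exchanges are
    bounded in terms of \<open>c\<close>.\<close>
  define c where "c = relaxed_objective S \<phi>0 (w0, \<delta>0)"
  obtain B where B: "\<And>\<phi> w \<delta> m l. \<phi> \<in> {0..1} \<Longrightarrow> (w, \<delta>) \<in> relaxed_feasible S \<phi> \<Longrightarrow>
    relaxed_objective S \<phi> (w, \<delta>) \<le> c \<Longrightarrow> m \<in> bsts S \<Longrightarrow> l \<in> nbrs S m \<Longrightarrow> \<bar>\<delta> m l\<bar> \<le> B m l"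
    using exchange_bounded[of c] by blast
  define W :: "'l beams set" where
    "W = {w. \<forall>m n. w m n \<in> (if m \<in> bsts S \<and> n \<in> act S m then cball 0 (sqrt (p_max S m)) else {0})}"
  define E :: "exchange set" where
    "E = {\<delta>. \<forall>m l. \<delta> m l \<in> (if m \<in> bsts S \<and> l \<in> nbrs S m then {- B m l..B m l} else {0})}"
  define K where "K = (\<Phi> \<times> W \<times> E) \<inter> {p. snd p \<in> relaxed_feasible S (fst p)}"
  define obj where "obj = (\<lambda>p. relaxed_objective S (fst p) (snd p))"
  have "compact W" "compact E"
    unfolding W_def E_def by (intro compact_fun2_box; simp)+
  then have "compact K"
    unfolding K_def using \<Phi>(1) by (intro compact_Int_closed compact_Times closed_relaxed_feasible)
  \<comment> \<open>Power limits bound the scheduled beams, \<open>B\<close> bounds the exchanges,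
    and trimming zeroes the rest; the objective does not change.\<close>
  have in_K: "(\<psi>, trim_beams v, trim_exchange \<epsilon>) \<in> K"
    if \<psi>: "\<psi> \<in> \<Phi>" and feas: "(v, \<epsilon>) \<in> relaxed_feasible S \<psi>"
      and obj: "relaxed_objective S \<psi> (v, \<epsilon>) \<le> c" for \<psi> v \<epsilon>
  proof -
    have "norm (v m n) \<le> sqrt (p_max S m)" if "m \<in> bsts S" "n \<in> act S m" for m n
    proof -
      have "(norm (v m n))\<^sup>2 \<le> (\<Sum>n\<in>act S m. (norm (v m n))\<^sup>2)"
        using that by (intro member_le_sum) auto
      also have "\<dots> \<le> p_max S m"
        using feas that by (auto simp: relaxed_feasible_def power_ok_def)
      finally show ?thesis
        by (rule real_le_rsqrt)
    qed
    then have "trim_beams v \<in> W"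
      by (auto simp: W_def trim_beams_def)
    moreover have "\<bar>\<epsilon> m l\<bar> \<le> B m l" if "m \<in> bsts S" "l \<in> nbrs S m" for m l
      using B[OF _ feas obj that] \<psi> \<Phi>(2) by blast
    then have "trim_exchange \<epsilon> \<in> E"
      by (fastforce simp: E_def trim_exchange_def abs_le_iff)
    ultimately show ?thesis
      using \<psi> relaxed_feasible_trim[OF feas] by (simp add: K_def)
  qed
  have "K \<noteq> {}"
    using in_K[OF \<phi>0] by (auto simp: c_def)
  moreover have "continuous_on K obj"
    unfolding obj_def by (rule continuous_on_relaxed_objective)
  ultimately obtain p where p: "p \<in> K" and min: "\<And>q. q \<in> K \<Longrightarrow> obj p \<le> obj q"
    using continuous_attains_inf[OF \<open>compact K\<close>] by metis
  have below: "obj p \<le> relaxed_objective S \<psi> (v, \<epsilon>)"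
    if "\<psi> \<in> \<Phi>" "(v, \<epsilon>) \<in> relaxed_feasible S \<psi>" "relaxed_objective S \<psi> (v, \<epsilon>) \<le> c" for \<psi> v \<epsilon>
    using min[OF in_K[OF that]] by (simp add: obj_def relaxed_objective_trim)
  show ?thesis
  proof (rule that[of "fst p" "fst (snd p)" "snd (snd p)"])
    fix \<psi> y assume y: "\<psi> \<in> \<Phi>" "y \<in> relaxed_feasible S \<psi>"
    obtain v \<epsilon> where [simp]: "y = (v, \<epsilon>)" by fastforce
    show "relaxed_objective S (fst p) (fst (snd p), snd (snd p)) \<le> relaxed_objective S \<psi> y"
    proof (cases "relaxed_objective S \<psi> y \<le> c")
      case True
      then show ?thesis
        using below y by (simp add: obj_def)
    next
      \<comment> \<open>A competitor worse than \<open>c\<close> loses already to the starting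
        point.\<close>
      case False
      then show ?thesis
        using below[OF \<phi>0] by (simp add: obj_def c_def)
    qed
  qed (use p in \<open>auto simp: K_def\<close>)
qed

section \<open>Rates and the passage between the two problems\<close>

lemma rate_inactive:
  assumes "m \<in> bsts S" "n \<in> users S m" "n \<notin> act S m"
  shows "rate S w m n = 0"
  using sched_01[OF assms(1,2)] assms(2,3) by (auto simp: rate_def act_def)

lemma rate_active:
  assumes "n \<in> act S m"
  shows "rate S w m n
     = ln (1 + (cmod (herm (chan S m m n) (w m n)))\<^sup>2 / disturbance S w m n)"
  using assms by (simp add: rate_def act_def disturbance_def)

lemma rate_nonneg:
  assumes "m \<in> bsts S" "n \<in> act S m"
  shows "0 \<le> rate S w m n"
  using disturbance_pos[OF assms(1) act_subset[OF assms(2)], of w] by (simp add: rate_active assms)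

text \<open>\<open>f_sinr\<close> inverts the rate formula: the rate is the backlog times \<phi>
  exactly when the SINR is the square of \<open>f_sinr S \<phi> m n\<close>. Taking roots gives
  active (b) with the modulus in place of the real part.\<close>

lemma rate_eq_iff:
  assumes mn: "m \<in> bsts S" "n \<in> act S m" and \<phi>: "0 \<le> \<phi>"
  shows "rate S w m n = backlog_slot S m n * \<phi> \<longleftrightarrow>
    cmod (herm (chan S m m n) (w m n)) = f_sinr S \<phi> m n * sqrt (disturbance S w m n)"
proof -
  define d x where "d = disturbance S w m n" and "x = cmod (herm (chan S m m n) (w m n))"
  note nu = act_subset[OF mn(2)]
  have d: "d > 0" using disturbance_pos[OF mn(1) nu] by (simp add: d_def)
  have f: "0 \<le> f_sinr S \<phi> m n" "(f_sinr S \<phi> m n)\<^sup>2 = exp (backlog_slot S m n * \<phi>) - 1"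
    using f_sinr_nonneg[OF mn(1) nu \<phi>] by auto
  have "0 < 1 + x\<^sup>2 / d"
    using d by (simp add: add_pos_nonneg)
  then have "ln (1 + x\<^sup>2 / d) = backlog_slot S m n * \<phi> \<longleftrightarrow> 1 + x\<^sup>2 / d = exp (backlog_slot S m n * \<phi>)"
    by (metis exp_ln ln_exp)
  also have "\<dots> \<longleftrightarrow> x\<^sup>2 / d = (f_sinr S \<phi> m n)\<^sup>2"
    by (auto simp: f(2))
  also have "\<dots> \<longleftrightarrow> x\<^sup>2 = (f_sinr S \<phi> m n * sqrt d)\<^sup>2"
    using d by (simp add: field_simps power_mult_distrib)
  also have "\<dots> \<longleftrightarrow> x = f_sinr S \<phi> m n * sqrt d"
    using d f(1) by (intro power2_eq_iff_nonneg) (auto simp: x_def)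
  finally show ?thesis
    by (simp add: rate_active[OF mn(2)] d_def x_def)
qed

lemma slot_objective_eq_relaxed_objective:
  assumes "\<And>m n. m \<in> bsts S \<Longrightarrow> n \<in> act S m \<Longrightarrow> rate S w m n = backlog_slot S m n * \<phi>"
  shows "slot_objective S (w, \<delta>) = relaxed_objective S \<phi> (w, \<delta>)"
proof -
  have "(\<Sum>n\<in>users S m. (backlogU S m n - backlogA S m n) * rate S w m n)
      = (\<Sum>n\<in>act S m. \<phi> * ((backlogU S m n - backlogA S m n) * backlog_slot S m n))"
    if "m \<in> bsts S" for m
    by (rule sum.mono_neutral_cong_right)
      (use assms that rate_inactive act_subset in \<open>auto\<close>)
  then show ?thesis
    by (simp add: slot_objective_def relaxed_objective_eq sum_distrib_left)
qed

text \<open>By (c) and active (b) the useful signal is real and nonnegative, so it equals its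
  modulus and each scheduled rate is backlog times \<phi>. Proportionality is then immediate, and
  \<phi> at most 1 gives the rate bound.\<close>

lemma slot_feasible_of_active:
  assumes feas: "(w, \<delta>) \<in> relaxed_feasible S \<phi>" and \<phi>: "\<phi> \<in> {0..1}"
    and active: "\<And>m n. m \<in> bsts S \<Longrightarrow> n \<in> act S m \<Longrightarrow> sinr_active S \<phi> w m n"
  shows "(w, trim_exchange \<delta>) \<in> slot_feasible S"
    and "slot_objective S (w, trim_exchange \<delta>) = relaxed_objective S \<phi> (w, \<delta>)"
proof -
  have rate: "rate S w m n = backlog_slot S m n * \<phi>" if mn: "m \<in> bsts S" "n \<in> act S m" for m n
  proof -
    have "0 \<le> Re (herm (chan S m m n) (w m n))"
      using active[OF mn] f_sinr_nonneg(1)[OF mn(1) act_subset[OF mn(2)], of \<phi>] \<phi>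
        disturbance_pos[OF mn(1) act_subset[OF mn(2)], of w]
      by (simp add: sinr_active_def disturbance_def)
    moreover have "Im (herm (chan S m m n) (w m n)) = 0"
      using feas mn by (auto simp: relaxed_feasible_def)
    ultimately have "cmod (herm (chan S m m n) (w m n)) = Re (herm (chan S m m n) (w m n))"
      by (simp add: cmod_def)
    then show ?thesis
      using active[OF mn] \<phi> mn by (simp add: rate_eq_iff sinr_active_def disturbance_def)
  qed
  have "rate S w m n \<le> backlog_slot S m n" if "m \<in> bsts S" "n \<in> users S m" for m n
    using that \<phi> backlog_nonneg[OF that] rate[of m n] rate_inactive[of m n w]
    by (cases "n \<in> act S m") (auto simp: mult_left_le)
  moreover have "trim_exchange \<delta> m l + trim_exchange \<delta> l m = 0" if "m \<in> bsts S" "l \<in> bsts S" for m l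
    using that feas by (intro trim_exchange_antisym) (auto simp: relaxed_feasible_def)
  ultimately show "(w, trim_exchange \<delta>) \<in> slot_feasible S"
    using feas by (auto simp: slot_feasible_def relaxed_feasible_def rate)
  show "slot_objective S (w, trim_exchange \<delta>) = relaxed_objective S \<phi> (w, \<delta>)"
    using rate by (subst slot_objective_eq_relaxed_objective[of w \<phi>])
      (simp_all add: relaxed_objective_def net_energy_trim)
qed

text \<open>Each slot-feasible beam is rotated by a phase that makes its useful signal real and
  nonnegative; rates, powers and interference do not see this rotation.\<close>

lemma relaxed_feasible_of_slot_feasible:
  assumes feas: "(w, \<delta>) \<in> slot_feasible S"
  obtains \<phi> v where "\<phi> \<in> {0..1}" "(v, \<delta>) \<in> relaxed_feasible S \<phi>"
    "relaxed_objective S \<phi> (v, \<delta>) = slot_objective S (w, \<delta>)"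
proof -
  have upper: "rate S w m n \<le> backlog_slot S m n" if "m \<in> bsts S" "n \<in> act S m" for m n
    using feas that act_subset by (auto simp: slot_feasible_def)
  have proportional: "rate S w m n * backlog_slot S j i = rate S w j i * backlog_slot S m n"
    if "m \<in> bsts S" "n \<in> act S m" "j \<in> bsts S" "i \<in> act S j" for m n j i
    using feas that by (auto simp: slot_feasible_def)
  obtain \<phi> where \<phi>: "\<phi> \<in> {0..1}"
    and rate: "\<And>m n. m \<in> bsts S \<Longrightarrow> n \<in> act S m \<Longrightarrow> rate S w m n = backlog_slot S m n * \<phi>"
  \<comment> \<open>The common ratio of rate to backlog is \<phi>. If no scheduled backlog is
    positive, all scheduled rates are squeezed to 0 and any \<phi> would fit; 0 is taken.\<close>
  proof (cases "\<exists>m\<in>bsts S. \<exists>n\<in>act S m. backlog_slot S m n > 0")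
    case True
    then obtain m n where mn: "m \<in> bsts S" "n \<in> act S m" "backlog_slot S m n > 0" by blast
    show ?thesis
    proof (rule that[of "rate S w m n / backlog_slot S m n"])
      show "rate S w m n / backlog_slot S m n \<in> {0..1}"
        using mn upper[OF mn(1,2)] rate_nonneg[OF mn(1,2)] by simp
      show "rate S w j i = backlog_slot S j i * (rate S w m n / backlog_slot S m n)"
        if "j \<in> bsts S" "i \<in> act S j" for j i
        using proportional[OF mn(1,2) that] mn(3) by (simp add: field_simps)
    qed
  next
    case False
    show ?thesis
    proof (rule that[of 0])
      show "rate S w m n = backlog_slot S m n * 0" if mn: "m \<in> bsts S" "n \<in> act S m" for m n
        using False upper[OF mn] rate_nonneg[OF mn, of w] mn by fastforce
    qed simp
  qed
  \<comment> \<open>The value 1 at \<open>z = 0\<close> keeps the factor of modulus 1, so norms are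
    preserved there too.\<close>
  define rot where "rot = (\<lambda>z. if z = 0 then 1 else cnj z / of_real (cmod z))"
  have rot: "cmod (rot z) = 1" "rot z * z = of_real (cmod z)" for z
    by (auto simp: rot_def norm_divide complex_norm_square[symmetric] power2_eq_square
        mult.commute[of "cnj z"])
  define v where "v = (\<lambda>m n. rot (herm (chan S m m n) (w m n)) *s w m n)"
  have norm_v: "norm (v m n) = norm (w m n)" for m n
    by (simp add: v_def norm_smult_complex rot)
  have herm_v: "herm (chan S m m n) (v m n) = of_real (cmod (herm (chan S m m n) (w m n)))" for m n
    by (simp add: v_def herm_smult rot)
  have dist_v: "disturbance S v m n = disturbance S w m n" if "m \<in> bsts S" for m n
    by (rule disturbance_cong[OF that]) (simp add: v_def herm_smult norm_mult rot)
  have "sinr_constr S \<phi> v m n" if mn: "m \<in> bsts S" "n \<in> act S m" for m n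
    using rate[OF mn] mn \<phi> dist_v[OF mn(1), of n]
    by (simp add: rate_eq_iff sinr_constr_def herm_v disturbance_def)
  moreover have "\<delta> m m = 0" if "m \<in> bsts S" for m
  proof -
    have "\<delta> m m + \<delta> m m = 0"
      using feas that unfolding slot_feasible_def by blast
    then show ?thesis by simp
  qed
  moreover have "\<delta> m l + \<delta> l m = 0" if "m \<in> bsts S" "l \<in> nbrs S m" for m l
    using feas that nbrs_subset[OF that(1)] unfolding slot_feasible_def by blast
  moreover have "power_ok S v"
    using feas by (simp add: slot_feasible_def power_ok_def norm_v)
  ultimately have "(v, \<delta>) \<in> relaxed_feasible S \<phi>"
    by (auto simp: relaxed_feasible_def herm_v)
  moreover have "relaxed_objective S \<phi> (v, \<delta>) = relaxed_objective S \<phi> (w, \<delta>)"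
    by (intro antisym relaxed_objective_mono) (simp_all add: norm_v)
  ultimately show ?thesis
    using that[OF \<phi>] slot_objective_eq_relaxed_objective[OF rate] by simp
qed

section \<open>Active optima and equality of the optimal values\<close>

text \<open>A minimizer exists for the given \<phi>, and the active point that dominates it is again
  a minimizer.\<close>

lemma relaxed_optimal_active_exists:
  assumes \<phi>: "\<phi> \<in> {0..1}" and "relaxed_feasible S \<phi> \<noteq> {}"
  shows "\<exists>w \<delta>. relaxed_optimal S \<phi> (w, \<delta>) \<and>
           (\<forall>m\<in>bsts S. \<forall>n\<in>act S m. sinr_active S \<phi> w m n)"
proof -
  obtain w0 \<delta>0 where "(w0, \<delta>0) \<in> relaxed_feasible S \<phi>"
    using assms(2) by auto
  moreover have "compact {\<phi>}" "{\<phi>} \<subseteq> {0..1}"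
    using \<phi> by auto
  ultimately obtain w \<delta> where w: "(w, \<delta>) \<in> relaxed_feasible S \<phi>"
    and min: "\<And>y. y \<in> relaxed_feasible S \<phi> \<Longrightarrow> relaxed_objective S \<phi> (w, \<delta>) \<le> relaxed_objective S \<phi> y"
    using relaxed_attains_min[of "{\<phi>}" \<phi> w0 \<delta>0] by (metis singletonD singletonI)
  obtain v where v: "(v, \<delta>) \<in> relaxed_feasible S \<phi>"
    "relaxed_objective S \<phi> (v, \<delta>) \<le> relaxed_objective S \<phi> (w, \<delta>)"
    "\<And>m n. m \<in> bsts S \<Longrightarrow> n \<in> act S m \<Longrightarrow> sinr_active S \<phi> v m n"
    using dominated_by_active[OF w] \<phi> by auto
  have "relaxed_optimal S \<phi> (v, \<delta>)"
    unfolding relaxed_optimal_def is_arg_min_linorder using v min by (meson order_trans)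
  then show ?thesis
    using v(3) by blast
qed

text \<open>At \<open>\<phi> = 0\<close> the factor \<open>f_sinr\<close> vanishes, so zero beams
  satisfy (b). This supplies the starting point for minimizing over all \<phi>.\<close>

lemma relaxed_feasible_at_0: "(\<lambda>_ _. 0, \<lambda>_ _. 0) \<in> relaxed_feasible S 0"
  using p_max_pos
  by (auto simp: relaxed_feasible_def sinr_constr_def f_sinr_def herm_zero power_ok_def less_imp_le)

text \<open>One joint minimizer serves both claims: its \<phi> attains the outer infimum, and its
  active replacement is feasible for the per-slot problem at no greater cost. Conversely, every
  per-slot point has a relaxed counterpart of equal cost.\<close>

lemma relaxation_tight:
  "(\<exists>\<phi>\<in>{0..1}. relaxed_value S \<phi> = relaxed_opt S) \<and> relaxed_opt S = slot_opt S"
proof -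
  obtain \<phi> w \<delta> where \<phi>: "\<phi> \<in> {0..1}" and w: "(w, \<delta>) \<in> relaxed_feasible S \<phi>"
    and min: "\<And>\<psi> y. \<psi> \<in> {0..1} \<Longrightarrow> y \<in> relaxed_feasible S \<psi> \<Longrightarrow>
       relaxed_objective S \<phi> (w, \<delta>) \<le> relaxed_objective S \<psi> y"
    using relaxed_attains_min[OF _ _ _ relaxed_feasible_at_0, of "{0..1}"] by auto
  define c where "c = relaxed_objective S \<phi> (w, \<delta>)"
  have value_ge: "ereal c \<le> relaxed_value S \<psi>" if "\<psi> \<in> {0..1}" for \<psi>
    unfolding relaxed_value_def c_def using min[OF that] by (intro INF_greatest) simp
  have "relaxed_value S \<phi> \<le> ereal c"
    unfolding relaxed_value_def c_def by (rule INF_lower[OF w])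
  then have value_\<phi>: "relaxed_value S \<phi> = ereal c"
    using value_ge[OF \<phi>] by simp
  have opt: "relaxed_opt S = ereal c"
    unfolding relaxed_opt_def
    by (intro antisym INF_lower2[OF \<phi>] INF_greatest value_ge) (simp_all add: value_\<phi>)
  obtain v where v: "(v, \<delta>) \<in> relaxed_feasible S \<phi>"
    "relaxed_objective S \<phi> (v, \<delta>) \<le> relaxed_objective S \<phi> (w, \<delta>)"
    "\<And>m n. m \<in> bsts S \<Longrightarrow> n \<in> act S m \<Longrightarrow> sinr_active S \<phi> v m n"
    using dominated_by_active[OF w] \<phi> by auto
  have "slot_opt S \<le> ereal c"
    unfolding slot_opt_def
    by (rule INF_lower2[OF slot_feasible_of_active(1)[OF v(1) \<phi> v(3)]])
      (use v(2) in \<open>simp_all add: slot_feasible_of_active(2)[OF v(1) \<phi> v(3)] c_def\<close>)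
  moreover have "ereal c \<le> slot_opt S"
    unfolding slot_opt_def
  proof (rule INF_greatest)
    fix x assume "x \<in> slot_feasible S"
    moreover obtain u \<epsilon> where x: "x = (u, \<epsilon>)" by fastforce
    ultimately obtain \<psi> v where "\<psi> \<in> {0..1}" "(v, \<epsilon>) \<in> relaxed_feasible S \<psi>"
      "relaxed_objective S \<psi> (v, \<epsilon>) = slot_objective S x"
      using relaxed_feasible_of_slot_feasible by metis
    then show "ereal c \<le> ereal (slot_objective S x)"
      using min unfolding c_def by fastforce
  qed
  ultimately show ?thesis
    using \<phi> value_\<phi> opt by (metis antisym)
qed

end

text \<open>Activity is stated in two strengths. When the selling price is 0, a BST with surplus
  energy can waste power at no cost, so an optimum may have slack and only the existence of an
  active one is claimed.\<close>

theorem mainTheorem3: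
  fixes S :: "('l::finite) slot_data"
  assumes "\<And>m n. m \<in> bsts S \<Longrightarrow> n \<in> users S m \<Longrightarrow> sched S m n \<in> {0, 1}"
    and "\<And>m n. m \<in> bsts S \<Longrightarrow> n \<in> users S m \<Longrightarrow> noise_pow S m n > 0"
    and "\<And>m. m \<in> bsts S \<Longrightarrow> nbrs S m \<subseteq> bsts S - {m}"
    and "\<And>m l. m \<in> bsts S \<Longrightarrow> l \<in> nbrs S m \<Longrightarrow> m \<in> nbrs S l"
    and "\<And>m l. m \<in> bsts S \<Longrightarrow> l \<in> nbrs S m \<Longrightarrow>
           line_eff S m l = line_eff S l m \<and> 0 < line_eff S m l \<and> line_eff S m l < 1"
    and "price_buy S > price_sell S" and "price_sell S \<ge> 0"
    and "amp_eff S > 0"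
    and "\<And>m. m \<in> bsts S \<Longrightarrow> p_max S m > 0"
    and "ctrl_V S > 0"
    and "num_slots S > 0"
    and "\<And>m n. m \<in> bsts S \<Longrightarrow> n \<in> users S m \<Longrightarrow> backlog_slot S m n \<ge> 0"
  shows "(\<forall>\<phi>\<in>{0..1}.
            (relaxed_feasible S \<phi> \<noteq> {} \<longrightarrow>
               (\<exists>w \<delta>. relaxed_optimal S \<phi> (w, \<delta>) \<and>
                  (\<forall>m\<in>bsts S. \<forall>n\<in>act S m. sinr_active S \<phi> w m n))) \<and>
            (price_sell S > 0 \<longrightarrow>
               (\<forall>w \<delta>. relaxed_optimal S \<phi> (w, \<delta>) \<longrightarrow>
                  (\<forall>m\<in>bsts S. \<forall>n\<in>act S m. sinr_active S \<phi> w m n))))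
       \<and> (\<exists>\<phi>\<in>{0..1}. relaxed_value S \<phi> = relaxed_opt S)
       \<and> relaxed_opt S = slot_opt S"
proof -
  interpret slot_problem S
    by unfold_locales (fact assms)+
  show ?thesis
    using relaxed_optimal_active_exists relaxed_optimal_imp_active relaxation_tight by auto
qed

end
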